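(* Let $E$ be the rose with infinite petals, i.e. the graph with exactly one vertex $v$ and a countably infinite set of edges $\{e_i: i\ge 1\}$ (each with $s(e_i)=r(e_i)=v$), and let $(X,\sigma)$ be the associated Deaconu-Renault system. Then $(X,\sigma)$ has the shadowing property.
   Context: $\mathbb N=\{1,2,\ldots\}$. Graphs. A graph is $E=(E^0,E^1,r,s)$ with $E^0,E^1$ countable and $r,s:E^1\to E^0$. A finite path is a vertex (length $0$) or a sequence of edges $\alpha=\alpha_1\ldots\alpha_k$ with $r(\alpha_i)=s(\alpha_{i+1})$ for $1\le i<k$ (length $|\alpha|=k$); $\mathfrak p$ is the set of finite paths, including vertices, and $\mathfrak p^\infty$ the set of infinite paths $\gamma_1\gamma_2\ldots$ (with $r(\gamma_i)=s(\gamma_{i+1})$). One sets $r(v)=s(v)=v$ for vertices, $r(\alpha)=r(\alpha_{|\alpha|})$, $s(\alpha)=s(\alpha_1)$, $s(\gamma)\gamma=\gamma$, and $\gamma r(\gamma)=\gamma$ for finite $\gamma$. A finite path $\gamma$ is an initial segment of a path $\beta$ if $\beta=\gamma\gamma'$ for some path $\gamma'$ (so $s(\beta)$ is an initial segment of $\beta$). A vertex $v$ is an infinite emitter if $s^{-1}(v)$ is infinite. The associated system. $X=\mathfrak p^\infty\cup X_{fin}$, where $X_{fin}=\{\alpha\in\mathfrak p: r(\alpha)\text{ is an infinite emitter}\}$. The map $\sigma$ has domain $\mathrm{Dom}(\sigma)=\{x\in X:|x|\ge1\}$ and deletes the first edge: $\sigma(\gamma_1\gamma_2\ldots)=\gamma_2\gamma_3\ldots$,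 $\sigma(\gamma_1\ldots\gamma_n)=\gamma_2\ldots\gamma_n$ for $n\ge2$, $\sigma(\gamma_1)=r(\gamma_1)$. Metric. With $E^1=\{e_1,e_2,\ldots\}$, fix an edge ordered enumeration $\mathfrak p=\{p_1,p_2,\ldots\}$, i.e. one such that for every $e_i$ the source of $e_i$ and all paths of length less than $i$ formed by edges $e_k$ with $k<i$ appear before $e_i$. For $x\ne y$ in $X$, $d(x,y)=1/2^i$ where $i$ is the smallest value such that $p_i$ is an initial segment of one of $x,y$ but not of the other; $d(x,x)=0$. Shadowing. A $\delta$-chain is an infinite sequence $(x_i)_{i=1}^\infty$ in $\mathrm{Dom}(\sigma)$ with $d(\sigma(x_i),x_{i+1})<\delta$ for all $i$. A point $x\in X$ $\varepsilon$-shadows $(y_i)_{i=1}^\infty$ if, for all $i$, $\sigma^{i-1}(x)$ is defined and $d(\sigma^{i-1}(x),y_i)<\varepsilon$. $(X,\sigma)$ has the shadowing property if for every $\varepsilon>0$ there is $\delta>0$ such that every $\delta$-chain is $\varepsilon$-shadowed by some $x\in X$. *)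

theory Defs
  imports
    Complex_Main
    "HOL-Library.Countable_Set"
    "HOL-Library.Extended_Nat"
    "HOL-Library.Stream"
    "Graph_Theory.Digraph"
begin

text \<open>
  A graph \<open>E = (E\<^sup>0, E\<^sup>1, r, s)\<close> is a record \<open>G\<close> with \<open>E\<^sup>0 = verts G\<close>, \<open>E\<^sup>1 = arcs G\<close>,
  \<open>r = head G\<close> and \<open>s = tail G\<close>.
\<close>

definition countable_graph :: "('a, 'b) pre_digraph \<Rightarrow> bool" where
  "countable_graph G \<longleftrightarrow> wf_digraph G \<and> countable (verts G) \<and> countable (arcs G)"

definition infinite_emitter :: "('a, 'b) pre_digraph \<Rightarrow> 'a \<Rightarrow> bool" where
  "infinite_emitter G v \<longleftrightarrow> v \<in> verts G \<and> infinite {e \<in> arcs G. tail G e = v}"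

text \<open>Well-formedness forces every edge to be a loop at the unique vertex.\<close>

definition infinite_rose :: "('a, 'b) pre_digraph \<Rightarrow> bool" where
  "infinite_rose G \<longleftrightarrow> countable_graph G \<and> (\<exists>v. verts G = {v}) \<and> infinite (arcs G)"


section \<open>Paths\<close>

text \<open>Paths of length 0, of finite length at least 1, and of infinite length, respectively.\<close>

datatype ('a, 'b) gpath = Vertex 'a | Edges "'b list" | Inf_path "'b stream"

definition fin_paths :: "('a, 'b) pre_digraph \<Rightarrow> ('a, 'b) gpath set" where
  "fin_paths G = Vertex ` verts G \<union>
     {Edges es | es. es \<noteq> [] \<and> set es \<subseteq> arcs G \<and>
        (\<forall>i. Suc i < length es \<longrightarrow> head G (es ! i) = tail G (es ! Suc i))}"

definition inf_paths :: "('a, 'b) pre_digraph \<Rightarrow> ('a, 'b) gpath set" where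
  "inf_paths G = {Inf_path w | w. sset w \<subseteq> arcs G \<and>
     (\<forall>i. head G (w !! i) = tail G (w !! Suc i))}"

fun plength :: "('a, 'b) gpath \<Rightarrow> enat" where
  "plength (Vertex v) = 0"
| "plength (Edges es) = enat (length es)"
| "plength (Inf_path w) = \<infinity>"

fun psource :: "('a, 'b) pre_digraph \<Rightarrow> ('a, 'b) gpath \<Rightarrow> 'a" where
  "psource G (Vertex v) = v"
| "psource G (Edges es) = tail G (hd es)"
| "psource G (Inf_path w) = tail G (shd w)"

fun prange :: "('a, 'b) pre_digraph \<Rightarrow> ('a, 'b) gpath \<Rightarrow> 'a" where
  "prange G (Vertex v) = v"
| "prange G (Edges es) = head G (last es)"
| "prange G (Inf_path w) = undefined"

text \<open>Concatenation; only meaningful if the first path is finite and its range is the source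
  of the second one.\<close>

fun pconcat :: "('a, 'b) gpath \<Rightarrow> ('a, 'b) gpath \<Rightarrow> ('a, 'b) gpath" where
  "pconcat (Vertex v) y = y"
| "pconcat (Edges es) (Vertex v) = Edges es"
| "pconcat (Edges es) (Edges fs) = Edges (es @ fs)"
| "pconcat (Edges es) (Inf_path w) = Inf_path (es @- w)"
| "pconcat (Inf_path w) y = undefined"

definition initial_segment ::
  "('a, 'b) pre_digraph \<Rightarrow> ('a, 'b) gpath \<Rightarrow> ('a, 'b) gpath \<Rightarrow> bool" where
  "initial_segment G g b \<longleftrightarrow> g \<in> fin_paths G \<and>
     (\<exists>g' \<in> fin_paths G \<union> inf_paths G. prange G g = psource G g' \<and> b = pconcat g g')"


section \<open>The associated system\<close>

definition path_space :: "('a, 'b) pre_digraph \<Rightarrow> ('a, 'b) gpath set" where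
  "path_space G = inf_paths G \<union> {x \<in> fin_paths G. infinite_emitter G (prange G x)}"

definition shift_dom :: "('a, 'b) pre_digraph \<Rightarrow> ('a, 'b) gpath set" where
  "shift_dom G = {x \<in> path_space G. 1 \<le> plength x}"

text \<open>Only the values on \<open>shift_dom G\<close> matter.\<close>

fun shift_map :: "('a, 'b) pre_digraph \<Rightarrow> ('a, 'b) gpath \<Rightarrow> ('a, 'b) gpath" where
  "shift_map G (Vertex v) = undefined"
| "shift_map G (Edges es) = (if length es = 1 then Vertex (head G (hd es)) else Edges (tl es))"
| "shift_map G (Inf_path w) = Inf_path (stl w)"

definition shift_iter_defined :: "('a, 'b) pre_digraph \<Rightarrow> nat \<Rightarrow> ('a, 'b) gpath \<Rightarrow> bool" where
  "shift_iter_defined G n x \<longleftrightarrow> x \<in> path_space G \<and> (\<forall>k<n. (shift_map G ^^ k) x \<in> shift_dom G)"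


section \<open>Enumerations and the metric\<close>

text \<open>
  Enumerations \<open>{a\<^sub>1, a\<^sub>2, \<dots>}\<close> are without repetition and start at index 1;
  the index set is \<open>{1..n}\<close> if the enumerated set has \<open>n\<close> elements.
\<close>

definition index_set :: "'c set \<Rightarrow> nat set" where
  "index_set A = {i. 1 \<le> i \<and> (finite A \<longrightarrow> i \<le> card A)}"

definition enumerates :: "(nat \<Rightarrow> 'c) \<Rightarrow> 'c set \<Rightarrow> bool" where
  "enumerates f A \<longleftrightarrow> bij_betw f (index_set A) A"

definition appears_before ::
  "('a, 'b) pre_digraph \<Rightarrow> (nat \<Rightarrow> ('a, 'b) gpath) \<Rightarrow> ('a, 'b) gpath \<Rightarrow> ('a, 'b) gpath \<Rightarrow> bool" where
  "appears_before G p a b \<longleftrightarrow>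
     (\<exists>j \<in> index_set (fin_paths G). \<exists>k \<in> index_set (fin_paths G). j < k \<and> p j = a \<and> p k = b)"

text \<open>Paths formed by edges are those of length at least 1.\<close>

definition edge_ordered_enumeration ::
  "('a, 'b) pre_digraph \<Rightarrow> (nat \<Rightarrow> 'b) \<Rightarrow> (nat \<Rightarrow> ('a, 'b) gpath) \<Rightarrow> bool" where
  "edge_ordered_enumeration G e p \<longleftrightarrow>
     enumerates e (arcs G) \<and> enumerates p (fin_paths G) \<and>
     (\<forall>i \<in> index_set (arcs G).
        appears_before G p (Vertex (tail G (e i))) (Edges [e i]) \<and>
        (\<forall>es. Edges es \<in> fin_paths G \<longrightarrow> length es < i \<longrightarrow>
           set es \<subseteq> e ` {k \<in> index_set (arcs G). k < i} \<longrightarrow>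
           appears_before G p (Edges es) (Edges [e i])))"

definition path_dist ::
  "('a, 'b) pre_digraph \<Rightarrow> (nat \<Rightarrow> ('a, 'b) gpath) \<Rightarrow> ('a, 'b) gpath \<Rightarrow> ('a, 'b) gpath \<Rightarrow> real" where
  "path_dist G p x y =
     (if x = y then 0
      else 1 / 2 ^ (LEAST i. i \<in> index_set (fin_paths G) \<and>
                       initial_segment G (p i) x \<noteq> initial_segment G (p i) y))"


section \<open>Shadowing\<close>

text \<open>Sequences are indexed from 1; their value at 0 is irrelevant.\<close>

definition delta_chain ::
  "('a, 'b) pre_digraph \<Rightarrow> (nat \<Rightarrow> ('a, 'b) gpath) \<Rightarrow> real \<Rightarrow> (nat \<Rightarrow> ('a, 'b) gpath) \<Rightarrow> bool" where
  "delta_chain G p \<delta> x \<longleftrightarrow>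
     (\<forall>i\<ge>1. x i \<in> shift_dom G \<and> path_dist G p (shift_map G (x i)) (x (i + 1)) < \<delta>)"

definition shadows ::
  "('a, 'b) pre_digraph \<Rightarrow> (nat \<Rightarrow> ('a, 'b) gpath) \<Rightarrow> real \<Rightarrow> ('a, 'b) gpath
     \<Rightarrow> (nat \<Rightarrow> ('a, 'b) gpath) \<Rightarrow> bool" where
  "shadows G p \<epsilon> x y \<longleftrightarrow>
     (\<forall>i\<ge>1. shift_iter_defined G (i - 1) x \<and>
        path_dist G p ((shift_map G ^^ (i - 1)) x) (y i) < \<epsilon>)"

definition shadowing_property ::
  "('a, 'b) pre_digraph \<Rightarrow> (nat \<Rightarrow> ('a, 'b) gpath) \<Rightarrow> bool" where
  "shadowing_property G p \<longleftrightarrow>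
     (\<forall>\<epsilon>>0. \<exists>\<delta>>0. \<forall>y. delta_chain G p \<delta> y \<longrightarrow> (\<exists>x \<in> path_space G. shadows G p \<epsilon> x y))"

end

theory Submission
  imports Defs "HOL-Library.Sublist"
begin

text \<open>
  Being close means having the same initial segments among finitely many words. Given a chain
  \<open>y\<close>, let \<open>x\<close> be the infinite word formed by the first edges of \<open>y 1, y 2, \<dots>\<close>; this is
  always a path since all edges are loops at the same vertex. A word \<open>a # w\<close> is an initial segment
  of \<open>y i\<close> iff \<open>a\<close> is the first edge of \<open>y i\<close> and \<open>w\<close> is an initial segment of the shift of
  \<open>y i\<close>, equivalently of \<open>y (i + 1)\<close> when \<open>\<delta>\<close> is small. By induction on words, \<open>y i\<close> and
  the shifts of \<open>x\<close> agree on every word all of whose suffixes are controlled by \<open>\<delta>\<close>.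
\<close>

section \<open>The metric as agreement on finitely many initial segments\<close>

lemma path_dist_less_imp_agree:
  assumes "path_dist G p x y < 1 / 2 ^ M" "i \<in> index_set (fin_paths G)" "i \<le> M"
  shows "initial_segment G (p i) x \<longleftrightarrow> initial_segment G (p i) y"
proof (rule ccontr)
  assume differ: "\<not> ?thesis"
  define l where "l = (LEAST i. i \<in> index_set (fin_paths G) \<and>
    initial_segment G (p i) x \<noteq> initial_segment G (p i) y)"
  have "l \<le> i"
    unfolding l_def using differ assms(2) by (intro Least_le) auto
  then have "(1::real) / 2 ^ M \<le> 1 / 2 ^ l"
    using assms(3) by (intro divide_left_mono power_increasing) auto
  moreover have "path_dist G p x y = 1 / 2 ^ l"
    using differ by (auto simp: path_dist_def l_def)
  ultimately show False
    using assms(1) by simp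
qed

text \<open>The hypothesis \<open>separated\<close> guarantees for distinct points that the
  \<open>LEAST\<close> in \<open>path_dist\<close> is a genuine separating index;
  \<open>agree\<close> then pushes this index beyond \<open>N\<close>.\<close>

lemma path_dist_less_if_agree:
  assumes separated: "x \<noteq> y \<Longrightarrow> \<exists>i \<in> index_set (fin_paths G).
      initial_segment G (p i) x \<noteq> initial_segment G (p i) y"
    and agree: "\<And>i. i \<in> index_set (fin_paths G) \<Longrightarrow> i \<le> N \<Longrightarrow>
      initial_segment G (p i) x \<longleftrightarrow> initial_segment G (p i) y"
  shows "path_dist G p x y < 1 / 2 ^ N"
proof (cases "x = y")
  case False
  define P where "P i \<longleftrightarrow> i \<in> index_set (fin_paths G) \<and>
    initial_segment G (p i) x \<noteq> initial_segment G (p i) y" for i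
  define l where "l = (LEAST i. P i)"
  have "\<exists>i. P i"
    using separated[OF False] unfolding P_def by blast
  then have "P l"
    unfolding l_def by (rule LeastI_ex)
  then have "N < l"
    using agree[of l] unfolding P_def by linarith
  then have "(1::real) / 2 ^ l < 1 / 2 ^ N"
    by (intro divide_strict_left_mono power_strict_increasing) auto
  then show ?thesis
    using False unfolding path_dist_def l_def P_def by simp
qed (simp add: path_dist_def)

text \<open>This turns a finite set of paths to be controlled into one exponent \<open>M\<close>,
  from which \<delta> is read off.\<close>

lemma enumerates_finite_subset_bounded:
  assumes "enumerates p A" "finite Q" "Q \<subseteq> A"
  obtains M where "\<And>q. q \<in> Q \<Longrightarrow> \<exists>j \<in> index_set A. j \<le> M \<and> p j = q"
proof -
  have "Q \<subseteq> p ` index_set A"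
    using assms by (auto simp: enumerates_def bij_betw_def)
  then obtain J where J: "J \<subseteq> index_set A" "finite J" "Q = p ` J"
    using finite_subset_image[OF assms(2)] by metis
  \<comment> \<open>If \<open>J\<close> is empty, \<open>Max J\<close> is unspecified, but then
    \<open>Q\<close> is empty and nothing is claimed.\<close>
  show thesis
    by (rule that[of "Max J"]) (use J Max_ge[of J] in blast)
qed

section \<open>Paths in the rose as words\<close>

fun edge_prefix :: "nat \<Rightarrow> ('a, 'b) gpath \<Rightarrow> 'b list" where
  "edge_prefix n (Vertex v) = []"
| "edge_prefix n (Edges es) = take n es"
| "edge_prefix n (Inf_path w) = stake n w"

fun first_edge :: "('a, 'b) gpath \<Rightarrow> 'b" where
  "first_edge (Vertex v) = undefined"
| "first_edge (Edges es) = hd es"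
| "first_edge (Inf_path w) = shd w"

text \<open>All edges are loops at \<open>v\<close>, so any edges can be composed; and
  \<open>v\<close> emits infinitely many edges, so every finite path is a point of the
  space.\<close>

lemma
  assumes "infinite_rose G" "verts G = {v}"
  shows rose_fin_paths: "fin_paths G = insert (Vertex v) {Edges es |es. es \<noteq> [] \<and> set es \<subseteq> arcs G}"
    and rose_inf_paths: "inf_paths G = {Inf_path w |w. sset w \<subseteq> arcs G}"
    and rose_path_space: "path_space G = fin_paths G \<union> inf_paths G"
    and rose_psource: "x \<in> fin_paths G \<union> inf_paths G \<Longrightarrow> psource G x = v"
    and rose_prange: "x \<in> fin_paths G \<Longrightarrow> prange G x = v"
proof -
  have wf: "wf_digraph G" and inf: "infinite (arcs G)"
    using assms(1) by (auto simp: infinite_rose_def countable_graph_def)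
  have ht: "head G a = v" "tail G a = v" if "a \<in> arcs G" for a
    using wf_digraph.head_in_verts[OF wf that] wf_digraph.tail_in_verts[OF wf that] assms(2) by auto
  show fin: "fin_paths G = insert (Vertex v) {Edges es |es. es \<noteq> [] \<and> set es \<subseteq> arcs G}"
    unfolding fin_paths_def assms(2)
    by (auto simp: ht subset_iff)
  show infp: "inf_paths G = {Inf_path w |w. sset w \<subseteq> arcs G}"
    unfolding inf_paths_def by (auto simp: ht subset_iff snth_sset simp del: snth.simps)
  show range: "prange G x = v" if "x \<in> fin_paths G" for x
    using that ht by (auto simp: fin subset_iff)
  show "psource G x = v" if "x \<in> fin_paths G \<union> inf_paths G"
    using that ht shd_sset by (fastforce simp: fin infp subset_iff)
  have "{a \<in> arcs G. tail G a = v} = arcs G"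
    using ht by auto
  then have "infinite_emitter G v"
    using inf assms(2) by (simp add: infinite_emitter_def)
  then show "path_space G = fin_paths G \<union> inf_paths G"
    by (auto simp: path_space_def range)
qed

lemma rose_initial_segment_Vertex:
  assumes "infinite_rose G" "verts G = {v}" "x \<in> path_space G"
  shows "initial_segment G (Vertex v) x"
proof -
  have "x \<in> fin_paths G \<union> inf_paths G" "Vertex v \<in> fin_paths G"
    using assms(3) by (simp_all add: rose_path_space[OF assms(1,2)] rose_fin_paths[OF assms(1,2)])
  then show ?thesis
    using rose_psource[OF assms(1,2), of x] unfolding initial_segment_def
    by (intro conjI bexI[of _ x]) simp_all
qed

text \<open>Short paths are returned whole by \<open>edge_prefix\<close>, so the equation also
  forces \<open>x\<close> to have at least \<open>length es\<close> edges. Conversely, whatever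
  remains after these edges is again a path, and it starts at \<open>v\<close>.\<close>

lemma rose_initial_segment_Edges:
  assumes "infinite_rose G" "verts G = {v}" "x \<in> path_space G" "Edges es \<in> fin_paths G"
  shows "initial_segment G (Edges es) x \<longleftrightarrow> edge_prefix (length es) x = es"
proof
  assume "initial_segment G (Edges es) x"
  then obtain g where "x = pconcat (Edges es) g"
    by (auto simp: initial_segment_def)
  then show "edge_prefix (length es) x = es"
    by (cases g) (simp_all add: stake_shift)
next
  note paths = rose_fin_paths[OF assms(1,2)] rose_inf_paths[OF assms(1,2)]
  assume prefix: "edge_prefix (length es) x = es"
  have "\<exists>g \<in> fin_paths G \<union> inf_paths G. x = pconcat (Edges es) g"
  proof (cases x)
    case (Vertex u)
    then show ?thesis
      using prefix assms(4) by (auto simp: paths)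
  next
    case (Edges fs)
    then have fs: "fs = es @ drop (length es) fs"
      using prefix by (metis append_take_drop_id edge_prefix.simps(2))
    show ?thesis
    proof (cases "drop (length es) fs = []")
      case True
      \<comment> \<open>An empty remainder has to be the vertex, because \<open>Edges []\<close> is
        not a path.\<close>
      then show ?thesis
        using fs Edges by (intro bexI[of _ "Vertex v"]) (auto simp: paths)
    next
      case False
      have "set fs \<subseteq> arcs G"
        using assms(3) Edges by (auto simp: rose_path_space[OF assms(1,2)] paths)
      then have "Edges (drop (length es) fs) \<in> fin_paths G"
        using False set_drop_subset[of "length es" fs] by (auto simp: paths)
      then show ?thesis
        using fs Edges by (intro bexI[of _ "Edges (drop (length es) fs)"]) auto
    qed
  next
    case (Inf_path w)
    then have w: "w = es @- sdrop (length es) w"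
      using prefix by (metis edge_prefix.simps(3) stake_sdrop)
    have "sset w \<subseteq> arcs G"
      using assms(3) Inf_path by (auto simp: rose_path_space[OF assms(1,2)] paths)
    then have "Inf_path (sdrop (length es) w) \<in> inf_paths G"
      by (subst (asm) w) (simp add: paths sset_shift)
    then show ?thesis
      using w Inf_path by (intro bexI[of _ "Inf_path (sdrop (length es) w)"]) auto
  qed
  then show "initial_segment G (Edges es) x"
    using assms(4) rose_psource[OF assms(1,2)] rose_prange[OF assms(1,2) assms(4)]
    by (auto simp: initial_segment_def simp del: prange.simps)
qed

text \<open>A long enough prefix of \<open>w\<close> is the separating path. One infinite path
  suffices here, since the shadowing point and its shifts are infinite.\<close>

lemma rose_initial_segment_separates:
  assumes "infinite_rose G" "verts G = {v}" "Inf_path w \<in> path_space G" "y \<in> path_space G"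
    and "Inf_path w \<noteq> y"
  obtains q where "q \<in> fin_paths G" "initial_segment G q (Inf_path w) \<noteq> initial_segment G q y"
proof -
  \<comment> \<open>Positivity of \<open>n\<close> makes \<open>stake n w\<close> nonempty, hence a
    path.\<close>
  have "\<exists>n. n > 0 \<and> edge_prefix n y \<noteq> stake n w"
  proof (cases y)
    case (Vertex u)
    then show ?thesis by (intro exI[of _ 1]) simp
  next
    case (Edges fs)
    \<comment> \<open>Even if \<open>fs\<close> is a prefix of \<open>w\<close>, one more edge tells
      them apart by length.\<close>
    then have "length (edge_prefix (Suc (length fs)) y) \<noteq> length (stake (Suc (length fs)) w)"
      by (simp del: stake.simps)
    then show ?thesis by (metis zero_less_Suc)
  next
    case (Inf_path w')
    then have "w' \<noteq> w"
      using assms(5) by simp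
    then obtain n where "w' !! n \<noteq> w !! n"
      using smap_alt[of id w w'] by (metis id_apply stream.map_id)
    then have "stake (Suc n) w' \<noteq> stake (Suc n) w"
      by (metis lessI stake_nth)
    then show ?thesis
      using Inf_path by (metis edge_prefix.simps(3) zero_less_Suc)
  qed
  then obtain n where n: "n > 0" "edge_prefix n y \<noteq> stake n w" by blast
  have "sset w \<subseteq> arcs G"
    using assms(3) by (auto simp: rose_path_space[OF assms(1,2)] rose_fin_paths[OF assms(1,2)]
        rose_inf_paths[OF assms(1,2)])
  moreover have "set (stake n w) \<subseteq> sset w"
    by (metis Un_upper1 sset_shift stake_sdrop)
  moreover have "stake n w \<noteq> []"
    using n(1) by (metis length_0_conv length_stake less_irrefl)
  ultimately have q: "Edges (stake n w) \<in> fin_paths G"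
    by (auto simp: rose_fin_paths[OF assms(1,2)])
  show thesis
    using that[OF q] rose_initial_segment_Edges[OF assms(1,2) assms(3) q]
      rose_initial_segment_Edges[OF assms(1,2) assms(4) q] n(2) by simp
qed

section \<open>Words and the shift\<close>

lemma edge_prefix_Suc_shift_map:
  assumes "x \<in> shift_dom G"
  shows "edge_prefix (Suc n) x = first_edge x # edge_prefix n (shift_map G x)"
proof (cases x)
  case (Edges es)
  then obtain a fs where "es = a # fs"
    using assms by (cases es) (auto simp: shift_dom_def zero_enat_def one_enat_def)
  \<comment> \<open>If \<open>fs\<close> is empty, the shift is a vertex, whose prefix is empty as
    required.\<close>
  then show ?thesis
    using Edges by simp
qed (use assms in \<open>auto simp: shift_dom_def\<close>)

lemma rose_first_edge_in_arcs:
  assumes "infinite_rose G" "x \<in> shift_dom G"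
  shows "first_edge x \<in> arcs G"
proof -
  obtain v where v: "verts G = {v}"
    using assms(1) by (auto simp: infinite_rose_def)
  show ?thesis
    using assms(2) shd_sset
    by (fastforce simp: shift_dom_def rose_path_space[OF assms(1) v] rose_fin_paths[OF assms(1) v]
        rose_inf_paths[OF assms(1) v])
qed

lemma rose_shift_map_in_path_space:
  assumes "infinite_rose G" "x \<in> shift_dom G"
  shows "shift_map G x \<in> path_space G"
proof -
  obtain v where v: "verts G = {v}"
    using assms(1) by (auto simp: infinite_rose_def)
  note paths = rose_path_space[OF assms(1) v] rose_fin_paths[OF assms(1) v]
    rose_inf_paths[OF assms(1) v]
  have head: "head G a = v" if "a \<in> arcs G" for a
    using rose_prange[OF assms(1) v, of "Edges [a]"] that by (auto simp: paths)
  have "x \<in> path_space G" "1 \<le> plength x"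
    using assms(2) by (auto simp: shift_dom_def)
  then show ?thesis
  proof (cases x)
    case (Edges es)
    then obtain a fs where "es = a # fs" "insert a (set fs) \<subseteq> arcs G"
      using \<open>x \<in> path_space G\<close> by (cases es) (auto simp: paths)
    then show ?thesis
      using Edges head by (auto simp: paths)
  next
    case (Inf_path w)
    then show ?thesis
      using \<open>x \<in> path_space G\<close> stl_sset by (fastforce simp: paths)
  qed auto
qed

text \<open>Stripping the first letter of \<open>w\<close> moves from \<open>y i\<close> to
  \<open>y (Suc i)\<close>, hence the condition on all suffixes and the induction with
  \<open>i\<close> arbitrary. Only equality with the test word is compared: the two prefixes
  themselves may differ.\<close>

lemma edge_prefix_chain_iff:
  assumes dom: "\<And>i. i \<ge> 1 \<Longrightarrow> y i \<in> shift_dom G"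
    and step: "\<And>i u. i \<ge> 1 \<Longrightarrow> suffix u w \<Longrightarrow>
      edge_prefix (length u) (shift_map G (y i)) = u \<longleftrightarrow> edge_prefix (length u) (y (Suc i)) = u"
    and "i \<ge> 1"
  shows "edge_prefix (length w) (y i) = w \<longleftrightarrow>
    stake (length w) (smap (\<lambda>k. first_edge (y k)) (fromN i)) = w"
  using step \<open>i \<ge> 1\<close>
proof (induction w arbitrary: i)
  case Nil
  then show ?case by (cases "y i") auto
next
  case (Cons a w)
  have "edge_prefix (length w) (y (Suc i)) = w \<longleftrightarrow>
      stake (length w) (smap (\<lambda>k. first_edge (y k)) (fromN (Suc i))) = w"
    using Cons.prems(1) by (intro Cons.IH) (simp_all add: suffix_ConsI)
  moreover have "edge_prefix (length w) (shift_map G (y i)) = w \<longleftrightarrow>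
      edge_prefix (length w) (y (Suc i)) = w"
    using Cons.prems by (simp add: suffix_ConsI)
  moreover have "stake (length (a # w)) (smap (\<lambda>k. first_edge (y k)) (fromN i)) =
      first_edge (y i) # stake (length w) (smap (\<lambda>k. first_edge (y k)) (fromN (Suc i)))"
    by (simp only: list.size add_Suc_right add_0_right stake.simps stream.map_sel siterate.sel)
  ultimately show ?case
    using edge_prefix_Suc_shift_map[OF dom[OF Cons.prems(2)], of "length w"]
    by (simp only: list.size add_Suc_right add_0_right list.inject)
qed

section \<open>Choice of \<delta> and the shadowing point\<close>

theorem proposition5p1:
  fixes G :: "('a, 'b) pre_digraph"
    and e :: "nat \<Rightarrow> 'b"
    and p :: "nat \<Rightarrow> ('a, 'b) gpath"
  assumes "infinite_rose G"
    and "edge_ordered_enumeration G e p"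
  shows "shadowing_property G p"
  unfolding shadowing_property_def
proof (intro allI impI)
  fix \<epsilon> :: real
  assume "\<epsilon> > 0"
  note rose = assms(1)
  obtain v where v: "verts G = {v}"
    using rose by (auto simp: infinite_rose_def)
  note paths = rose_fin_paths[OF rose v] rose_inf_paths[OF rose v] rose_path_space[OF rose v]
  have enum: "enumerates p (fin_paths G)"
    using assms(2) by (simp add: edge_ordered_enumeration_def)
  then have p_fin: "p i \<in> fin_paths G" if "i \<in> index_set (fin_paths G)" for i
    using that by (auto simp: enumerates_def bij_betw_def)
  obtain N where N: "1 / 2 ^ N < \<epsilon>"
    using real_arch_pow_inv[OF \<open>\<epsilon> > 0\<close>, of "1/2"] by (auto simp: power_one_over)
  \<comment> \<open>These are the words to be tested for \<epsilon>-closeness. \<open>Q\<close>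
    closes them under suffixes, leaving out the empty word, which gives no path.\<close>
  define F where "F = {es. Edges es \<in> p ` {i \<in> index_set (fin_paths G). i \<le> N}}"
  define Q where "Q = (Edges ` ((\<Union>es\<in>F. set (suffixes es)) - {[]}) :: ('a, 'b) gpath set)"
  have "F = Edges -` (p ` {i \<in> index_set (fin_paths G). i \<le> N})"
    by (auto simp: F_def)
  then have "finite F"
    by (simp add: finite_vimageI inj_def)
  then have "finite Q"
    by (simp add: Q_def)
  moreover have "Q \<subseteq> fin_paths G"
  proof -
    have "set es \<subseteq> arcs G" if "es \<in> F" for es
      using that p_fin by (fastforce simp: F_def paths)
    then show ?thesis
      using set_mono_suffix by (fastforce simp: Q_def paths)
  qed
  ultimately obtain M where M: "\<And>q. q \<in> Q \<Longrightarrow> \<exists>j \<in> index_set (fin_paths G). j \<le> M \<and> p j = q"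
    using enumerates_finite_subset_bounded[OF enum] by metis
  show "\<exists>\<delta>>0. \<forall>y. delta_chain G p \<delta> y \<longrightarrow> (\<exists>x\<in>path_space G. shadows G p \<epsilon> x y)"
  proof (intro exI[of _ "1 / 2 ^ M"] conjI allI impI)
    fix y
    assume chain: "delta_chain G p (1 / 2 ^ M) y"
    have dom: "y i \<in> shift_dom G"
      and close: "path_dist G p (shift_map G (y i)) (y (Suc i)) < 1 / 2 ^ M" if "i \<ge> 1" for i
      using chain that by (auto simp: delta_chain_def)
    have y_in: "y i \<in> path_space G" if "i \<ge> 1" for i
      using dom[OF that] by (simp add: shift_dom_def)
    \<comment> \<open>The shadowing point is \<open>Inf_path (z 1)\<close>; the other
      \<open>z i\<close> are its shifts, with the index offset by one since chains start at
      1.\<close>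
    define z where "z i = smap (\<lambda>k. first_edge (y k)) (fromN i)" for i
    have "sset (z i) \<subseteq> arcs G" if "i \<ge> 1" for i
      using that rose_first_edge_in_arcs[OF rose dom] by (auto simp: z_def stream.set_map)
    then have z_in: "Inf_path (z i) \<in> path_space G" if "i \<ge> 1" for i
      using that by (simp add: paths)
    have z_dom: "Inf_path (z i) \<in> shift_dom G" if "i \<ge> 1" for i
      using z_in[OF that] by (simp add: shift_dom_def)
    have shift: "(shift_map G ^^ k) (Inf_path (z 1)) = Inf_path (z (Suc k))" for k
      by (induction k) (simp_all add: z_def)
    have step: "edge_prefix (length u) (shift_map G (y i)) = u \<longleftrightarrow>
        edge_prefix (length u) (y (Suc i)) = u"
      if "i \<ge> 1" "w \<in> F" "suffix u w" for i u w
    proof (cases "u = []")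
      case True
      then show ?thesis
        by (cases "shift_map G (y i)"; cases "y (Suc i)") auto
    next
      case False
      then have "Edges u \<in> Q"
        using that unfolding Q_def by (intro imageI) auto
      then obtain j where j: "j \<in> index_set (fin_paths G)" "j \<le> M" "p j = Edges u"
        using M by blast
      have u: "Edges u \<in> fin_paths G"
        using p_fin[OF j(1)] j(3) by simp
      show ?thesis
        using path_dist_less_imp_agree[OF close[OF that(1)] j(1,2)] j(3) y_in[of "Suc i"]
          rose_initial_segment_Edges[OF rose v rose_shift_map_in_path_space[OF rose dom[OF that(1)]] u]
          rose_initial_segment_Edges[OF rose v _ u]
        by auto
    qed
    have "path_dist G p (Inf_path (z i)) (y i) < 1 / 2 ^ N" if i: "i \<ge> 1" for i
    proof (rule path_dist_less_if_agree)
      assume "Inf_path (z i) \<noteq> y i"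
      then obtain q where q: "q \<in> fin_paths G"
        "initial_segment G q (Inf_path (z i)) \<noteq> initial_segment G q (y i)"
        by (rule rose_initial_segment_separates[OF rose v z_in[OF i] y_in[OF i]])
      have "q \<in> p ` index_set (fin_paths G)"
        using q(1) enum by (simp add: enumerates_def bij_betw_def)
      then show "\<exists>j \<in> index_set (fin_paths G).
          initial_segment G (p j) (Inf_path (z i)) \<noteq> initial_segment G (p j) (y i)"
        using q(2) by auto
    next
      fix j
      assume j: "j \<in> index_set (fin_paths G)" "j \<le> N"
      consider "p j = Vertex v" | w where "p j = Edges w"
        using p_fin[OF j(1)] by (auto simp: paths)
      \<comment> \<open>The vertex is an initial segment of every point, so only words need the
        chain argument.\<close>
      then show "initial_segment G (p j) (Inf_path (z i)) \<longleftrightarrow> initial_segment G (p j) (y i)"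
      proof cases
        case 1
        then show ?thesis
          using rose_initial_segment_Vertex[OF rose v] z_in[OF i] y_in[OF i] by simp
      next
        case 2
        then have "w \<in> F"
          using j by (force simp: F_def)
        then have "edge_prefix (length w) (y i) = w \<longleftrightarrow> stake (length w) (z i) = w"
          unfolding z_def using dom step i by (intro edge_prefix_chain_iff) auto
        moreover have "Edges w \<in> fin_paths G"
          using p_fin[OF j(1)] 2 by simp
        ultimately show ?thesis
          using 2 rose_initial_segment_Edges[OF rose v] z_in[OF i] y_in[OF i] by simp
      qed
    qed
    then have "path_dist G p (Inf_path (z i)) (y i) < \<epsilon>" if "i \<ge> 1" for i
      using N that less_trans by blast
    \<comment> \<open>All iterates are defined because every shift of an infinite path is
      infinite.\<close>
    then have "shadows G p \<epsilon> (Inf_path (z 1)) y"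
      unfolding shadows_def shift_iter_defined_def shift using z_in z_dom by simp
    then show "\<exists>x\<in>path_space G. shadows G p \<epsilon> x y"
      using z_in by blast
  qed simp
qed

end
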